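(* Let $\Gamma$ be a set of s-formulas, and suppose that there is a tableau for $\Gamma$ such that every maximal branch of the tableau is closed. Then no frame satisfies $\Gamma$.
   Context: Fix an infinite (possibly uncountable) set $\Sigma$ of propositional variables. Propositional formulas are built from $\Sigma$ using $\lnot$, $\land$, $\lor$, $\to$. An s-formula is an expression of the form $A \prec B$ (a strict implication) or $A \not\prec B$ (a strict nonimplication), where $A$ and $B$ are propositional formulas; $\prec$ and $\not\prec$ are two formal symbols, not nested. A valuation is a function $w:\Sigma\to\{T,F\}$, extended in the usual way to all propositional formulas. A frame is a nonempty set of valuations. A frame $R$ satisfies $A \prec B$ if for every $w\in R$, $w(A)=F$ or $w(B)=T$. A frame $R$ satisfies $A\not\prec B$ if there is some $w\in R$ with $w(A)=T$ and $w(B)=F$. A frame satisfies a set of s-formulas if it satisfies every member. Fix an infinite set $W$ of world variables. A tableau formula is either an s-formula or an expression $(A,w)$ with $A$ a propositional formula and $w\in W$. A tableau for a set $\Gamma$ of tableau formulas is a finite tree whose nodes are labeled by (possibly infinite) sets of tableau formulas, whose root is labeled $\Gamma$, and in which the children of each non-leaf node are obtained from that node by one of the following rules. Below, $\Delta$ is any set of tableau formulas, "$\Delta,\varphi$" means $\Delta\cup\{\varphi\}$ ($\Delta$ may itself contain $\varphi$), the label of the parent is on the left of $\Rightarrow$ and the labels of its one or two children (separated by $\mid$) are on the right: - ($\lor$) $\Delta,(A\lor B,w)\Rightarrow \Delta,(A,w)\mid \Delta,(B,w)$ - ($\lnot\lor$) $\Delta,(\lnot(A\lor B),w)\Rightarrow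 \Delta,(\lnot A,w),(\lnot B,w)$ - ($\land$) $\Delta,(A\land B,w)\Rightarrow \Delta,(A,w),(B,w)$ - ($\lnot\land$) $\Delta,(\lnot(A\land B),w)\Rightarrow \Delta,(\lnot A,w)\mid \Delta,(\lnot B,w)$ - ($\to$) $\Delta,(A\to B,w)\Rightarrow \Delta,(\lnot A,w)\mid\Delta,(B,w)$ - ($\lnot\to$) $\Delta,(\lnot(A\to B),w)\Rightarrow\Delta,(A,w),(\lnot B,w)$ - ($\prec$) $\Delta, A\prec B\Rightarrow \Delta,(\lnot A,w)\mid\Delta,(B,w)$, for any $w\in W$ - ($\not\prec$) $\Delta, A\not\prec B\Rightarrow \Delta,(A,v),(\lnot B,v)$, where $v\in W$ is new: it is not mentioned in the label of the node where the rule is applied or of any of its ancestors - ($C$) $\Delta\Rightarrow \Delta,(A,w)\mid\Delta,(\lnot A,w)$, for any propositional formula $A$ and $w\in W$ - ($\lnot\lnot$) $\Delta,(\lnot\lnot A,w)\Rightarrow\Delta,(A,w)$. A branch is closed if it contains a node whose label contains both $(A,w)$ and $(\lnot A,w)$ for some propositional formula $A$ and some $w\in W$. A tableau is closed if every maximal branch is closed. *)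

theory Defs
  imports Main
begin

datatype 'p fm =
    Var 'p
  | Neg "'p fm"
  | Conj "'p fm" "'p fm"
  | Disj "'p fm" "'p fm"
  | Imp "'p fm" "'p fm"

datatype 'p sfm =
    StrictImp "'p fm" "'p fm"  (infix "\<prec>" 55)
  | StrictNonimp "'p fm" "'p fm"  (infix "\<nprec>" 55)

primrec eval :: "('p \<Rightarrow> bool) \<Rightarrow> 'p fm \<Rightarrow> bool" where
  "eval w (Var p) = w p"
| "eval w (Neg A) = (\<not> eval w A)"
| "eval w (Conj A B) = (eval w A \<and> eval w B)"
| "eval w (Disj A B) = (eval w A \<or> eval w B)"
| "eval w (Imp A B) = (eval w A \<longrightarrow> eval w B)"

definition frame :: "('p \<Rightarrow> bool) set \<Rightarrow> bool" where
  "frame R \<longleftrightarrow> R \<noteq> {}"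

primrec satisfies :: "('p \<Rightarrow> bool) set \<Rightarrow> 'p sfm \<Rightarrow> bool" where
  "satisfies R (A \<prec> B) \<longleftrightarrow> (\<forall>w\<in>R. \<not> eval w A \<or> eval w B)"
| "satisfies R (A \<nprec> B) \<longleftrightarrow> (\<exists>w\<in>R. eval w A \<and> \<not> eval w B)"

definition satisfies_set :: "('p \<Rightarrow> bool) set \<Rightarrow> 'p sfm set \<Rightarrow> bool" where
  "satisfies_set R \<Gamma> \<longleftrightarrow> (\<forall>\<phi>\<in>\<Gamma>. satisfies R \<phi>)"

datatype ('p, 'w) tfm =
    SForm "'p sfm"
  | At "'p fm" 'w

primrec worlds :: "('p, 'w) tfm \<Rightarrow> 'w set" where
  "worlds (SForm \<phi>) = {}"
| "worlds (At A w) = {w}"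

definition mentions :: "('p, 'w) tfm set \<Rightarrow> 'w \<Rightarrow> bool" where
  "mentions L w \<longleftrightarrow> (\<exists>\<phi>\<in>L. w \<in> worlds \<phi>)"

text \<open>
  \<open>rule anc L Ls\<close>: a node labeled \<open>L\<close> whose proper ancestors have the labels \<open>anc\<close> may be given
  children with the labels \<open>Ls\<close>. The set \<open>\<Delta>\<close> is arbitrary, so the principal formula may be kept
  or dropped.
\<close>

inductive rule ::
  "('p, 'w) tfm set set \<Rightarrow> ('p, 'w) tfm set \<Rightarrow> ('p, 'w) tfm set list \<Rightarrow> bool"
  for anc where
  disj: "rule anc (insert (At (Disj A B) w) \<Delta>) [insert (At A w) \<Delta>, insert (At B w) \<Delta>]"
| neg_disj: "rule anc (insert (At (Neg (Disj A B)) w) \<Delta>) [{At (Neg A) w, At (Neg B) w} \<union> \<Delta>]"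
| conj: "rule anc (insert (At (Conj A B) w) \<Delta>) [{At A w, At B w} \<union> \<Delta>]"
| neg_conj: "rule anc (insert (At (Neg (Conj A B)) w) \<Delta>)
    [insert (At (Neg A) w) \<Delta>, insert (At (Neg B) w) \<Delta>]"
| imp: "rule anc (insert (At (Imp A B) w) \<Delta>) [insert (At (Neg A) w) \<Delta>, insert (At B w) \<Delta>]"
| neg_imp: "rule anc (insert (At (Neg (Imp A B)) w) \<Delta>) [{At A w, At (Neg B) w} \<union> \<Delta>]"
| strict_imp: "rule anc (insert (SForm (A \<prec> B)) \<Delta>)
    [insert (At (Neg A) w) \<Delta>, insert (At B w) \<Delta>]"
| strict_nonimp: "rule anc (insert (SForm (A \<nprec> B)) \<Delta>) [{At A v, At (Neg B) v} \<union> \<Delta>]"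
    if "\<forall>K \<in> insert (insert (SForm (A \<nprec> B)) \<Delta>) anc. \<not> mentions K v"
| cut: "rule anc \<Delta> [insert (At A w) \<Delta>, insert (At (Neg A) w) \<Delta>]"
| neg_neg: "rule anc (insert (At (Neg (Neg A)) w) \<Delta>) [insert (At A w) \<Delta>]"

datatype 'l tree = Node (label: 'l) (children: "'l tree list")

inductive tableau_below :: "('p, 'w) tfm set set \<Rightarrow> ('p, 'w) tfm set tree \<Rightarrow> bool" where
  leaf: "tableau_below anc (Node L [])"
| step: "rule anc L (map label ts) \<Longrightarrow> \<forall>t\<in>set ts. tableau_below (insert L anc) t
    \<Longrightarrow> tableau_below anc (Node L ts)"

definition tableau_for :: "('p, 'w) tfm set \<Rightarrow> ('p, 'w) tfm set tree \<Rightarrow> bool" where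
  "tableau_for \<Gamma> t \<longleftrightarrow> label t = \<Gamma> \<and> tableau_below {} t"

text \<open>
  A branch is given by the list of labels along it; the maximal ones are the paths from the root
  to a leaf.
\<close>

inductive maximal_branch :: "'l tree \<Rightarrow> 'l list \<Rightarrow> bool" where
  "maximal_branch (Node L []) [L]"
| "t \<in> set ts \<Longrightarrow> maximal_branch t b \<Longrightarrow> maximal_branch (Node L ts) (L # b)"

definition closed_branch :: "('p, 'w) tfm set list \<Rightarrow> bool" where
  "closed_branch b \<longleftrightarrow> (\<exists>L\<in>set b. \<exists>A w. At A w \<in> L \<and> At (Neg A) w \<in> L)"

definition closed_tableau :: "('p, 'w) tfm set tree \<Rightarrow> bool" where
  "closed_tableau t \<longleftrightarrow> (\<forall>b. maximal_branch t b \<longrightarrow> closed_branch b)"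

end

theory Submission
  imports Defs
begin

text \<open>
  Interpret world variables by members of the frame. Every rule preserves satisfiability of a label
  in the frame: one of the children of a satisfiable node is again satisfiable. So a
  tableau for a satisfied set has a maximal branch of satisfiable labels, which cannot be closed.
  The interpretation may change along the branch, since (\<open>\<nprec>\<close>) reassigns its new world variable.
\<close>

primrec holds :: "('p \<Rightarrow> bool) set \<Rightarrow> ('w \<Rightarrow> 'p \<Rightarrow> bool) \<Rightarrow> ('p, 'w) tfm \<Rightarrow> bool" where
  "holds R \<sigma> (SForm \<phi>) = satisfies R \<phi>"
| "holds R \<sigma> (At A w) = eval (\<sigma> w) A"

definition satisfiable_in :: "('p \<Rightarrow> bool) set \<Rightarrow> ('p, 'w) tfm set \<Rightarrow> bool" where
  "satisfiable_in R L \<longleftrightarrow> (\<exists>\<sigma>. range \<sigma> \<subseteq> R \<and> (\<forall>\<phi>\<in>L. holds R \<sigma> \<phi>))"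

lemma satisfiable_inI:
  "range \<sigma> \<subseteq> R \<Longrightarrow> \<forall>\<phi>\<in>L. holds R \<sigma> \<phi> \<Longrightarrow> satisfiable_in R L"
  unfolding satisfiable_in_def by blast

lemma holds_fun_upd: "v \<notin> worlds \<phi> \<Longrightarrow> holds R (\<sigma>(v := u)) \<phi> = holds R \<sigma> \<phi>"
  by (cases \<phi>) auto

lemma rule_preserves_satisfiability:
  assumes "rule anc L Ls" and "satisfiable_in R L"
  shows "\<exists>K\<in>set Ls. satisfiable_in R K"
proof -
  obtain \<sigma> where ran: "range \<sigma> \<subseteq> R" and hold: "\<forall>\<phi>\<in>L. holds R \<sigma> \<phi>"
    using assms(2) unfolding satisfiable_in_def by blast
  show ?thesis
  \<comment> \<open>For every rule but \<nprec> the old \<open>\<sigma>\<close> already satisfies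
    some child, so the second case is contradictory there; only \<nprec> needs a new
    interpretation.\<close>
  proof (cases "\<exists>K\<in>set Ls. \<forall>\<phi>\<in>K. holds R \<sigma> \<phi>")
    case True
    then show ?thesis using ran satisfiable_inI by blast
  next
    case False
    from assms(1) show ?thesis
    proof cases
      case (strict_imp A B \<Delta> w)
      \<comment> \<open>The rule may pick any \<open>w\<close>, even one the label does not mention;
        since \<open>\<sigma>\<close> sends every world variable into \<open>R\<close>, the
        implication applies at \<open>\<sigma> w\<close>.\<close>
      have "\<sigma> w \<in> R" using ran by blast
      with False hold strict_imp show ?thesis by auto
    next
      case (strict_nonimp A B \<Delta> v)
      obtain u where u: "u \<in> R" "eval u A" "\<not> eval u B"
        using hold strict_nonimp(1) by auto
      \<comment> \<open>As \<open>v\<close> does not occur in \<open>\<Delta>\<close>, it can be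
        moved to the counterexample \<open>u\<close> without affecting
        \<open>\<Delta>\<close>.\<close>
      have "\<forall>\<phi>\<in>\<Delta>. holds R (\<sigma>(v := u)) \<phi>"
        using hold strict_nonimp by (auto simp: mentions_def holds_fun_upd)
      then have "satisfiable_in R ({At A v, At (Neg B) v} \<union> \<Delta>)"
        using ran u by (intro satisfiable_inI[of "\<sigma>(v := u)"]) auto
      then show ?thesis using strict_nonimp(2) by simp
    qed (use False hold in auto)
  qed
qed

text \<open>Descend from the root, always to a satisfiable child; the tree is finite, so this stops
  at a leaf.\<close>

lemma satisfiable_maximal_branch:
  assumes "tableau_below anc t" and "satisfiable_in R (label t)"
  shows "\<exists>b. maximal_branch t b \<and> (\<forall>L\<in>set b. satisfiable_in R L)"
  using assms
proof (induction rule: tableau_below.induct)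
  case (leaf anc L)
  then show ?case by (auto intro!: exI[of _ "[L]"] maximal_branch.intros)
next
  case (step anc L ts)
  obtain t where "t \<in> set ts" "satisfiable_in R (label t)"
    using rule_preserves_satisfiability[OF step.hyps(1)] step.prems by auto
  with step obtain b where "maximal_branch t b" "\<forall>K\<in>set b. satisfiable_in R K"
    by blast
  with \<open>t \<in> set ts\<close> step.prems show ?case
    by (intro exI[of _ "L # b"]) (auto intro: maximal_branch.intros)
qed

text \<open>A clash lies within a single label, so it does no harm that different labels of the
  branch may have different interpretations.\<close>

lemma satisfiable_branch_not_closed:
  "\<forall>L\<in>set b. satisfiable_in R L \<Longrightarrow> \<not> closed_branch b"
  unfolding closed_branch_def satisfiable_in_def by (metis eval.simps(2) holds.simps(2))

theorem theorem8:
  fixes \<Gamma> :: "'p sfm set"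
  assumes "infinite (UNIV :: 'p set)"
    and "infinite (UNIV :: 'w set)"
    and "\<exists>t :: ('p, 'w) tfm set tree. tableau_for (SForm ` \<Gamma>) t \<and> closed_tableau t"
  shows "\<not> (\<exists>R. frame R \<and> satisfies_set R \<Gamma>)"
proof
  assume "\<exists>R. frame R \<and> satisfies_set R \<Gamma>"
  then obtain R u where "u \<in> R" and sat: "satisfies_set R \<Gamma>"
    unfolding frame_def by blast
  obtain t :: "('p, 'w) tfm set tree"
    where t: "label t = SForm ` \<Gamma>" "tableau_below {} t" and closed: "closed_tableau t"
    using assms(3) unfolding tableau_for_def by blast
  have "satisfiable_in R (label t)"
    using \<open>u \<in> R\<close> sat unfolding t(1)
    \<comment> \<open>The root contains only s-formulas, whose truth does not depend on the
      interpretation, so a constant one will do; \<open>u\<close> exists because frames are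
      nonempty.\<close>
    by (intro satisfiable_inI[of "\<lambda>_. u"]) (auto simp: satisfies_set_def)
  then obtain b where "maximal_branch t b" "\<forall>L\<in>set b. satisfiable_in R L"
    using satisfiable_maximal_branch[OF t(2)] by blast
  then show False
    using closed satisfiable_branch_not_closed unfolding closed_tableau_def by blast
qed

end
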